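(* Every $F\in GW_0$ can be written in the form $$F(\mathbf q)=\sum_{n\ge 0}(q_1^1)^{2-n}c_n,$$ where, for each $n\ge 0$, $c_n$ is a series homogeneous of degree $n$ in the variables $q^\alpha_k$ with $(\alpha,k)\neq(1,1)$ (in particular $c_n$ does not depend on $q_1^1$).
   Context: $H$ is an $N$-dimensional complex vector space with a symmetric non-degenerate bilinear form $(\cdot,\cdot)$ and a distinguished nonzero vector $\mathbf 1$; $\{\phi_\alpha\}_{\alpha=1}^N$ is a basis with $\phi_1=\mathbf 1$, $g_{\alpha,\beta}=(\phi_\alpha,\phi_\beta)$, and $(g^{\alpha,\beta})$ is the inverse matrix of $(g_{\alpha,\beta})$. Variables: $t_n=\sum_\alpha t_n^\alpha\phi_\alpha\in H$, $n\ge 0$. Functions $F(t_0,t_1,\dots)$ are formal power series in the variables $t_n^\alpha$. The dilaton shifted variables are $q_n^\alpha=t_n^\alpha-\delta_{\alpha,1}\delta_{n,1}$, $q_n=\sum_\alpha q_n^\alpha\phi_\alpha$, and $\partial_{\alpha,n}=\partial/\partial t_n^\alpha=\partial/\partial q_n^\alpha$. Integer powers of $q_1^1=t_1^1-1$ (including negative ones) are expanded as power series in $t_1^1$. Repeated Greek indices are summed. $GW_0$ is the set of all $F$ satisfying (DE) $\sum_{i\ge 0}q_i^\alpha\partial_{\alpha,i}F=2F$; (SE) $\sum_{i\ge 0}q_{i+1}^\alpha\partial_{\alpha,i}F=-\frac12(q_0,q_0)$; (TRR) $\partial_{\alpha,k+1}\partial_{\beta,l}\partial_{\gamma,m}F=\partial_{\alpha,k}\partial_{\mu,0}F\;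 g^{\mu,\nu}\;\partial_{\nu,0}\partial_{\beta,l}\partial_{\gamma,m}F$ for all $k,l,m\ge 0$ and all $\alpha,\beta,\gamma\in\{1,\dots,N\}$. *)

theory Defs
  imports
    "HOL-Analysis.Analysis"
    "HOL-Library.Poly_Mapping"
    "HOL-Computational_Algebra.Formal_Power_Series"
begin

section \<open>Formal power series in an arbitrary family of variables\<close>

text \<open>
  A monomial is a finitely supported exponent function. A formal power series in the (possibly
  infinitely many) variables \<open>'v\<close> is an arbitrary function from monomials to coefficients.
\<close>

abbreviation "lookup \<equiv> Poly_Mapping.lookup"
abbreviation "keys \<equiv> Poly_Mapping.keys"

typedef ('v, 'a) mps = "UNIV :: (('v \<Rightarrow>\<^sub>0 nat) \<Rightarrow> 'a) set"
  morphisms mps_coeff Abs_mps ..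

lemma mps_coeff_Abs [simp]: "mps_coeff (Abs_mps f) = f"
  by (simp add: Abs_mps_inverse)

lemma mps_eqI: "(\<And>m. mps_coeff F m = mps_coeff G m) \<Longrightarrow> F = G"
  by (metis ext mps_coeff_inject)

definition splits :: "('v \<Rightarrow>\<^sub>0 nat) \<Rightarrow> (('v \<Rightarrow>\<^sub>0 nat) \<times> ('v \<Rightarrow>\<^sub>0 nat)) set" where
  "splits m = {(a, b). a + b = m}"

lemma finite_le_monom: "finite {a :: 'v \<Rightarrow>\<^sub>0 nat. \<exists>b. a + b = m}"
proof (rule finite_imageD)
  let ?r = "\<lambda>a :: 'v \<Rightarrow>\<^sub>0 nat. restrict (lookup a) (keys m)"
  let ?A = "{a :: 'v \<Rightarrow>\<^sub>0 nat. \<exists>b. a + b = m}"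
  have "?r ` ?A \<subseteq> PiE (keys m) (\<lambda>v. {..lookup m v})"
    by (auto simp: PiE_iff lookup_add)
  moreover have "finite (PiE (keys m) (\<lambda>v. {..lookup m v}))"
    by (intro finite_PiE) auto
  ultimately show "finite (?r ` ?A)"
    by (rule finite_subset)
  show "inj_on ?r ?A"
  proof (rule inj_onI)
    fix a a' assume a: "a \<in> ?A" "a' \<in> ?A" and eq: "?r a = ?r a'"
    show "a = a'"
    proof (rule poly_mapping_eqI)
      fix v
      show "lookup a v = lookup a' v"
      proof (cases "v \<in> keys m")
        case True
        then show ?thesis using fun_cong[OF eq, of v] by simp
      next
        case False
        then have "lookup m v = 0" by (simp add: in_keys_iff)
        moreover have "lookup d v \<le> lookup m v" if "d \<in> ?A" for d
          using that by (auto simp: lookup_add)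
        ultimately show ?thesis using a by fastforce
      qed
    qed
  qed
qed

lemma finite_splits [simp]: "finite (splits m)"
proof -
  have "splits m \<subseteq> {a. \<exists>b. a + b = m} \<times> {a. \<exists>b. a + b = m}"
    by (auto simp: splits_def) (metis add.commute)
  then show ?thesis
    by (rule finite_subset) (intro finite_cartesian_product finite_le_monom)
qed

instantiation mps :: (type, comm_ring_1) comm_ring_1
begin

definition "0 = Abs_mps (\<lambda>_. 0)"
definition "1 = Abs_mps (\<lambda>m. if m = 0 then 1 else 0)"
definition "F + G = Abs_mps (\<lambda>m. mps_coeff F m + mps_coeff G m)"
definition "F - G = Abs_mps (\<lambda>m. mps_coeff F m - mps_coeff G m)"
definition "- F = Abs_mps (\<lambda>m. - mps_coeff F m)"
definition "F * G = Abs_mps (\<lambda>m. \<Sum>(a, b)\<in>splits m. mps_coeff F a * mps_coeff G b)"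

instance
proof
  fix F G H :: "('a, 'b) mps"
  show "F + G + H = F + (G + H)" "F + G = G + F" "0 + F = F" "- F + F = 0" "F - G = F + - G"
    by (simp_all add: plus_mps_def zero_mps_def minus_mps_def uminus_mps_def mps_coeff_inverse
        algebra_simps)
  show "F * G = G * F"
  proof (rule mps_eqI)
    fix m
    show "mps_coeff (F * G) m = mps_coeff (G * F) m"
      unfolding times_mps_def mps_coeff_Abs
      by (rule sum.reindex_bij_witness[of _ prod.swap prod.swap])
         (auto simp: splits_def algebra_simps)
  qed
  show "(F + G) * H = F * H + G * H"
    by (rule mps_eqI)
       (simp add: plus_mps_def times_mps_def algebra_simps sum.distrib case_prod_unfold)
  show "1 * F = F"
  proof (rule mps_eqI)
    fix m
    have "mps_coeff (1 * F) m = (\<Sum>p\<in>splits m. if p = (0, m) then mps_coeff F m else 0)"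
      unfolding times_mps_def one_mps_def mps_coeff_Abs
      by (rule sum.cong) (auto simp: splits_def split: if_splits)
    also have "\<dots> = mps_coeff F m"
      by (simp add: sum.delta) (simp add: splits_def)
    finally show "mps_coeff (1 * F) m = mps_coeff F m" .
  qed
  show "F * G * H = F * (G * H)"
  proof (rule mps_eqI)
    fix m
    let ?f = "mps_coeff F" and ?g = "mps_coeff G" and ?h = "mps_coeff H"
    have "mps_coeff (F * G * H) m =
        (\<Sum>p\<in>splits m. \<Sum>r\<in>splits (fst p). ?f (fst r) * ?g (snd r) * ?h (snd p))"
      by (simp add: times_mps_def case_prod_unfold sum_distrib_right)
    also have "\<dots> = (\<Sum>(p, r)\<in>Sigma (splits m) (\<lambda>p. splits (fst p)).
        ?f (fst r) * ?g (snd r) * ?h (snd p))"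
      by (subst sum.Sigma) auto
    also have "\<dots> = (\<Sum>(p, r)\<in>Sigma (splits m) (\<lambda>p. splits (snd p)).
        ?f (fst p) * (?g (fst r) * ?h (snd r)))"
      by (rule sum.reindex_bij_witness[of _
            "\<lambda>(p, r). ((fst p + fst r, snd r), (fst p, fst r))"
            "\<lambda>(p, r). ((fst r, snd r + snd p), (snd r, snd p))"])
         (auto simp: splits_def algebra_simps)
    also have "\<dots> = (\<Sum>p\<in>splits m. \<Sum>r\<in>splits (snd p). ?f (fst p) * (?g (fst r) * ?h (snd r)))"
      by (subst sum.Sigma) auto
    also have "\<dots> = mps_coeff (F * (G * H)) m"
      by (simp add: times_mps_def case_prod_unfold sum_distrib_left)
    finally show "mps_coeff (F * G * H) m = mps_coeff (F * (G * H)) m" .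
  qed
  show "(0 :: ('a, 'b) mps) \<noteq> 1"
  proof
    assume "(0 :: ('a, 'b) mps) = 1"
    then have "mps_coeff (0 :: ('a, 'b) mps) 0 = mps_coeff 1 0" by simp
    then show False by (simp add: zero_mps_def one_mps_def)
  qed
qed

end

definition mps_const :: "'a::comm_ring_1 \<Rightarrow> ('v, 'a) mps" where
  "mps_const c = Abs_mps (\<lambda>m. if m = 0 then c else 0)"

definition mps_var :: "'v \<Rightarrow> ('v, 'a::comm_ring_1) mps" where
  "mps_var v = Abs_mps (\<lambda>m. if m = Poly_Mapping.single v 1 then 1 else 0)"

definition mps_deriv :: "'v \<Rightarrow> ('v, 'a::comm_ring_1) mps \<Rightarrow> ('v, 'a) mps" where
  "mps_deriv v F =
     Abs_mps (\<lambda>m. of_nat (lookup m v + 1) * mps_coeff F (m + Poly_Mapping.single v 1))"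

text \<open>
  Infinite sums of formal power series: the family is required to be locally finite (each monomial
  occurs in only finitely many members), and the sum is formed coefficientwise. Families whose
  \<open>i\<close>-th member is, for almost all \<open>i\<close>, a combination of multiples of variables from pairwise
  disjoint finite sets, as in \<open>DE\<close> and \<open>SE\<close> below, are always locally finite.
\<close>

definition mps_sums :: "(nat \<Rightarrow> ('v, 'a::comm_ring_1) mps) \<Rightarrow> ('v, 'a) mps \<Rightarrow> bool"
    (infixr "mps'_sums" 50) where
  "f mps_sums S \<longleftrightarrow>
     (\<forall>m. finite {i. mps_coeff (f i) m \<noteq> 0} \<and>
          mps_coeff S m = (\<Sum>i | mps_coeff (f i) m \<noteq> 0. mps_coeff (f i) m))"

definition homogeneous_in :: "'v set \<Rightarrow> nat \<Rightarrow> ('v, 'a::comm_ring_1) mps \<Rightarrow> bool" where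
  "homogeneous_in V n F \<longleftrightarrow>
     (\<forall>m. mps_coeff F m \<noteq> 0 \<longrightarrow> keys m \<subseteq> V \<and> (\<Sum>v\<in>keys m. lookup m v) = n)"

text \<open>A univariate formal power series, read as a series in the variable \<open>v\<close> alone.\<close>

definition mps_of_fps :: "'v \<Rightarrow> 'a::comm_ring_1 fps \<Rightarrow> ('v, 'a) mps" where
  "mps_of_fps v f = Abs_mps (\<lambda>m. if keys m \<subseteq> {v} then fps_nth f (lookup m v) else 0)"

lemma keys_subset_single_iff: "keys m \<subseteq> {v} \<longleftrightarrow> m = Poly_Mapping.single v (lookup m v)"
proof
  assume "keys m \<subseteq> {v}"
  then show "m = Poly_Mapping.single v (lookup m v)"
    by (intro poly_mapping_eqI) (auto simp: lookup_single when_def in_keys_iff subset_iff)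
next
  assume "m = Poly_Mapping.single v (lookup m v)"
  then show "keys m \<subseteq> {v}" by (metis keys_single empty_subsetI order_refl)
qed

lemma mps_of_fps_1: "mps_of_fps v 1 = 1"
  by (rule mps_eqI) (auto simp: mps_of_fps_def one_mps_def keys_subset_single_iff)

lemma mps_of_fps_diff: "mps_of_fps v (f - g) = mps_of_fps v f - mps_of_fps v g"
  by (rule mps_eqI) (simp add: mps_of_fps_def minus_mps_def)

lemma mps_of_fps_X: "mps_of_fps v fps_X = mps_var v"
  by (rule mps_eqI) (auto simp: mps_of_fps_def mps_var_def keys_subset_single_iff fps_X_def)

lemma mps_of_fps_mult: "mps_of_fps v (f * g) = mps_of_fps v f * mps_of_fps v g"
proof (rule mps_eqI)
  fix m
  show "mps_coeff (mps_of_fps v (f * g)) m = mps_coeff (mps_of_fps v f * mps_of_fps v g) m"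
  proof (cases "keys m \<subseteq> {v}")
    case True
    then have m: "m = Poly_Mapping.single v (lookup m v)"
      by (simp add: keys_subset_single_iff)
    have sub: "keys a \<subseteq> {v}" "keys b \<subseteq> {v}" "lookup a v + lookup b v = lookup m v"
      if "a + b = m" for a b
    proof -
      have "lookup a w + lookup b w = lookup m w" for w
        using that by (metis lookup_add)
      moreover have "lookup m w = 0" if "w \<noteq> v" for w
        using True that by (auto simp: in_keys_iff subset_iff)
      ultimately show "keys a \<subseteq> {v}" "keys b \<subseteq> {v}" "lookup a v + lookup b v = lookup m v"
        by (auto simp: in_keys_iff) (metis add_is_0 gr_implies_not0)+
    qed
    have "mps_coeff (mps_of_fps v f * mps_of_fps v g) m =
        (\<Sum>p\<in>splits m. fps_nth f (lookup (fst p) v) * fps_nth g (lookup (snd p) v))"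
      unfolding times_mps_def mps_coeff_Abs
    proof (rule sum.cong)
      fix p assume "p \<in> splits m"
      then show "(case p of (a, b) \<Rightarrow> mps_coeff (mps_of_fps v f) a * mps_coeff (mps_of_fps v g) b) =
          fps_nth f (lookup (fst p) v) * fps_nth g (lookup (snd p) v)"
        using sub(1,2)[of "fst p" "snd p"]
        by (simp add: mps_of_fps_def splits_def case_prod_unfold)
    qed simp
    also have "\<dots> = (\<Sum>i = 0..lookup m v. fps_nth f i * fps_nth g (lookup m v - i))"
    proof (rule sum.reindex_bij_witness[of _
          "\<lambda>i. (Poly_Mapping.single v i, Poly_Mapping.single v (lookup m v - i))"
          "\<lambda>p. lookup (fst p) v"])
      fix p assume p: "p \<in> splits m"
      obtain a b where ab: "p = (a, b)" "a + b = m" using p by (auto simp: splits_def)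
      from sub[OF ab(2)] have
        "a = Poly_Mapping.single v (lookup a v)" "b = Poly_Mapping.single v (lookup b v)"
        "lookup b v = lookup m v - lookup a v"
        by (simp_all add: keys_subset_single_iff[symmetric])
      then show "(Poly_Mapping.single v (lookup (fst p) v),
           Poly_Mapping.single v (lookup m v - lookup (fst p) v)) = p"
        by (metis ab(1) fst_conv)
      show "lookup (fst p) v \<in> {0..lookup m v}" using sub(3)[OF ab(2)] ab by simp
      show "fps_nth f (lookup (fst p) v) * fps_nth g (lookup m v - lookup (fst p) v) =
            fps_nth f (lookup (fst p) v) * fps_nth g (lookup (snd p) v)"
        using sub(3)[OF ab(2)] ab by (metis add_diff_cancel_left' fst_conv snd_conv)
    next
      fix i assume "i \<in> {0..lookup m v}"
      then show "(Poly_Mapping.single v i, Poly_Mapping.single v (lookup m v - i)) \<in> splits m"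
        using m by (simp add: splits_def flip: single_add)
    qed simp
    also have "\<dots> = mps_coeff (mps_of_fps v (f * g)) m"
      using True by (simp add: mps_of_fps_def fps_mult_nth)
    finally show ?thesis ..
  next
    case False
    have "\<not> (keys a \<subseteq> {v} \<and> keys b \<subseteq> {v})" if "a + b = m" for a b
      using that False Poly_Mapping.keys_add[of a b] by blast
    then have "mps_coeff (mps_of_fps v f * mps_of_fps v g) m = 0"
      unfolding times_mps_def mps_coeff_Abs
      by (intro sum.neutral) (auto simp: mps_of_fps_def splits_def)
    then show ?thesis using False by (simp add: mps_of_fps_def)
  qed
qed


section \<open>The space of states and the genus zero axioms\<close>

text \<open>
  The complex vector space \<open>H\<close> is the whole type \<open>'h\<close> with scalar multiplication \<open>scale\<close>. Its basis
  is indexed by a finite type \<open>'n\<close>, so the dimension is \<open>N = CARD('n)\<close>; the index written 1 on paper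
  is the distinguished element \<open>e\<close>.
\<close>

locale state_space = vector_space scale
  for scale :: "complex \<Rightarrow> 'h::ab_group_add \<Rightarrow> 'h"
  and form :: "'h \<Rightarrow> 'h \<Rightarrow> complex"
  and unit :: 'h
  and \<phi> :: "'n::finite \<Rightarrow> 'h"
  and e :: 'n +
  assumes form_linear_left: "\<And>y. Vector_Spaces.linear scale (*) (\<lambda>x. form x y)"
    and form_linear_right: "\<And>x. Vector_Spaces.linear scale (*) (\<lambda>y. form x y)"
    and form_symmetric: "\<And>x y. form x y = form y x"
    and form_nondegenerate: "\<And>x. (\<And>y. form x y = 0) \<Longrightarrow> x = 0"
    and unit_nonzero: "unit \<noteq> 0"
    and basis_inj: "inj \<phi>"
    and basis_independent: "independent (range \<phi>)"
    and basis_span: "span (range \<phi>) = UNIV"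
    and basis_unit: "\<phi> e = unit"

definition gram :: "('h \<Rightarrow> 'h \<Rightarrow> complex) \<Rightarrow> ('n::finite \<Rightarrow> 'h) \<Rightarrow> complex^'n^'n" where
  "gram form \<phi> = (\<chi> \<alpha> \<beta>. form (\<phi> \<alpha>) (\<phi> \<beta>))"

text \<open>The variable \<open>(\<alpha>, n)\<close> stands for the coordinate \<open>t\<close> with upper index \<open>\<alpha>\<close> and lower index \<open>n\<close>.
  The dilaton shift only affects \<open>(e, 1)\<close>, so homogeneity in the other \<open>q\<close>-variables is homogeneity
  in the other \<open>t\<close>-variables.\<close>

type_synonym 'n tseries = "('n \<times> nat, complex) mps"

definition q :: "'n \<Rightarrow> 'n \<Rightarrow> nat \<Rightarrow> 'n tseries" where
  "q e \<alpha> n = mps_var (\<alpha>, n) - (if \<alpha> = e \<and> n = 1 then 1 else 0)"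

abbreviation pd :: "'n \<Rightarrow> nat \<Rightarrow> 'n tseries \<Rightarrow> 'n tseries" where
  "pd \<alpha> n \<equiv> mps_deriv (\<alpha>, n)"

definition DE :: "'n::finite \<Rightarrow> 'n tseries \<Rightarrow> bool" where
  "DE e F \<longleftrightarrow> (\<lambda>i. \<Sum>\<alpha>\<in>UNIV. q e \<alpha> i * pd \<alpha> i F) mps_sums (2 * F)"

definition SE :: "('h \<Rightarrow> 'h \<Rightarrow> complex) \<Rightarrow> ('n::finite \<Rightarrow> 'h) \<Rightarrow> 'n \<Rightarrow> 'n tseries \<Rightarrow> bool" where
  "SE form \<phi> e F \<longleftrightarrow>
     (\<lambda>i. \<Sum>\<alpha>\<in>UNIV. q e \<alpha> (i + 1) * pd \<alpha> i F) mps_sums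
       (mps_const (- 1 / 2) *
         (\<Sum>\<alpha>\<in>UNIV. \<Sum>\<beta>\<in>UNIV. mps_const (gram form \<phi> $ \<alpha> $ \<beta>) * q e \<alpha> 0 * q e \<beta> 0))"

definition TRR :: "('h \<Rightarrow> 'h \<Rightarrow> complex) \<Rightarrow> ('n::finite \<Rightarrow> 'h) \<Rightarrow> 'n tseries \<Rightarrow> bool" where
  "TRR form \<phi> F \<longleftrightarrow>
     (\<forall>k l m \<alpha> \<beta> \<gamma>.
        pd \<alpha> (k + 1) (pd \<beta> l (pd \<gamma> m F)) =
        (\<Sum>\<mu>\<in>UNIV. \<Sum>\<nu>\<in>UNIV.
           pd \<alpha> k (pd \<mu> 0 F) * mps_const (matrix_inv (gram form \<phi>) $ \<mu> $ \<nu>) *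
           pd \<nu> 0 (pd \<beta> l (pd \<gamma> m F))))"

definition GW0 :: "('h \<Rightarrow> 'h \<Rightarrow> complex) \<Rightarrow> ('n::finite \<Rightarrow> 'h) \<Rightarrow> 'n \<Rightarrow> 'n tseries set" where
  "GW0 form \<phi> e = {F. DE e F \<and> SE form \<phi> e F \<and> TRR form \<phi> F}"

text \<open>
  Integer powers of \<open>q e e 1 = mps_var (e, 1) - 1\<close>: the constant term is \<open>-1\<close>, so the integer power
  of \<open>fps_X - 1\<close> exists in the univariate power series; it is read in the variable \<open>(e, 1)\<close>.
\<close>

definition q11_powi :: "'n \<Rightarrow> int \<Rightarrow> 'n tseries" where
  "q11_powi e k = mps_of_fps (e, 1) ((fps_X - 1) powi k)"

lemma q11_powi_of_nat: "q11_powi e (int n) = q e e 1 ^ n"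
  by (induction n)
     (simp_all add: q11_powi_def q_def power_int_of_nat mps_of_fps_1 mps_of_fps_mult
        mps_of_fps_diff mps_of_fps_X del: of_nat_Suc)

lemma q11_powi_minus: "q11_powi e (- int n) * q e e 1 ^ n = 1"
proof -
  have "inverse (fps_X - 1 :: complex fps) * (fps_X - 1) = 1"
    by (rule inverse_mult_eq_1) simp
  then have "inverse (fps_X - 1 :: complex fps) ^ n * (fps_X - 1) ^ n = 1"
    by (metis power_mult_distrib power_one)
  then have "(fps_X - 1 :: complex fps) powi (- int n) * (fps_X - 1) powi int n = 1"
    by (cases "n = 0") (simp_all add: power_int_def)
  then show ?thesis
    unfolding q11_powi_of_nat[symmetric] q11_powi_def
    by (simp only: mps_of_fps_mult[symmetric] mps_of_fps_1)
qed

end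

(* Let f(k) be the coefficient of F at r * (t_1^1)^k, for a monomial r of degree n not involving
   t_1^1. The dilaton equation reads (k + 1) f(k + 1) = (k + n - 2) f(k), which is the recursion
   satisfied by the coefficients of (t_1^1 - 1)^(2 - n). So c_n collects the terms of F of degree n
   free of t_1^1, up to the sign (-1)^n, the value of (t_1^1 - 1)^(2 - n) at 0. *)
theory Submission
  imports Defs
begin

lemma mps_coeff_diff: "mps_coeff (F - G) m = mps_coeff F m - mps_coeff G m"
  by (simp add: minus_mps_def)

lemma mps_coeff_sum: "mps_coeff (\<Sum>i\<in>A. f i) m = (\<Sum>i\<in>A. mps_coeff (f i) m)"
  by (induction A rule: infinite_finite_induct) (simp_all add: zero_mps_def plus_mps_def)

lemma mps_coeff_times: "mps_coeff (F * G) m = (\<Sum>(a, b)\<in>splits m. mps_coeff F a * mps_coeff G b)"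
  by (simp add: times_mps_def)

text \<open>Frees \<open>mps_sums\<close> from its exact support: indices with vanishing coefficient
  may be added, so any convenient finite index set computes the coefficient.\<close>

lemma mps_sums_coeff:
  assumes "f mps_sums S" and "finite I" and "\<And>i. i \<notin> I \<Longrightarrow> mps_coeff (f i) m = 0"
  shows "mps_coeff S m = (\<Sum>i\<in>I. mps_coeff (f i) m)"
proof -
  have "mps_coeff S m = (\<Sum>i | mps_coeff (f i) m \<noteq> 0. mps_coeff (f i) m)"
    using assms(1) by (simp add: mps_sums_def)
  also have "\<dots> = (\<Sum>i\<in>I. mps_coeff (f i) m)"
    using assms(2,3) by (intro sum.mono_neutral_left) auto
  finally show ?thesis .
qed

text \<open>The Euler operator of a variable is diagonal on monomials: multiplication by the
  variable undoes the exponent shift made by \<open>mps_deriv\<close>.\<close>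

lemma mps_coeff_var_times_deriv:
  "mps_coeff (mps_var v * mps_deriv v F) m = of_nat (lookup m v) * mps_coeff F m"
proof -
  let ?s = "Poly_Mapping.single v (1::nat)"
  have eq: "mps_coeff (mps_var v * mps_deriv v F) m =
      (\<Sum>p\<in>splits m. if fst p = ?s then of_nat (lookup m v) * mps_coeff F m else 0)"
    unfolding mps_coeff_times
    by (rule sum.cong)
      (auto simp: splits_def mps_var_def mps_deriv_def lookup_add add.commute)
  show ?thesis
  proof (cases "lookup m v = 0")
    case True
    then show ?thesis unfolding eq by (intro trans[OF sum.neutral]) simp_all
  next
    \<comment> \<open>Exponents are subtracted with truncation, so \<open>m - ?s\<close> is a
      genuine quotient only because \<open>v\<close> occurs in \<open>m\<close>.\<close>
    case False
    then have "?s + (m - ?s) = m"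
      by (intro poly_mapping_eqI) (auto simp: lookup_add lookup_minus lookup_single when_def)
    then have "p \<in> splits m \<and> fst p = ?s \<longleftrightarrow> p = (?s, m - ?s)" for p
      by (auto simp: splits_def)
    then have "{p \<in> splits m. fst p = ?s} = {(?s, m - ?s)}"
      by blast
    then show ?thesis
      unfolding eq by (simp flip: sum.inter_filter)
  qed
qed

text \<open>\<open>G\<close> is free of \<open>v\<close>, so the whole power of \<open>v\<close> in
  \<open>m\<close> must come from \<open>f\<close>, and a single splitting of \<open>m\<close>
  survives in the product.\<close>

lemma mps_coeff_of_fps_times:
  assumes "\<And>b. v \<in> keys b \<Longrightarrow> mps_coeff G b = 0"
  shows "mps_coeff (mps_of_fps v f * G) m =
    fps_nth f (lookup m v) * mps_coeff G (m - Poly_Mapping.single v (lookup m v))"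
proof -
  let ?s = "Poly_Mapping.single v (lookup m v)"
  have "?s + (m - ?s) = m"
    by (intro poly_mapping_eqI) (auto simp: lookup_add lookup_minus lookup_single when_def)
  then have mem: "(?s, m - ?s) \<in> splits m"
    by (simp add: splits_def)
  have zero: "mps_coeff (mps_of_fps v f) a * mps_coeff G b = 0"
    if "(a, b) \<in> splits m" "(a, b) \<noteq> (?s, m - ?s)" for a b
  proof (rule ccontr)
    assume "mps_coeff (mps_of_fps v f) a * mps_coeff G b \<noteq> 0"
    then have "keys a \<subseteq> {v}" and "v \<notin> keys b"
      using assms by (auto simp: mps_of_fps_def split: if_splits)
    then have "a = Poly_Mapping.single v (lookup a v)" and "lookup b v = 0"
      by (simp_all only: keys_subset_single_iff in_keys_iff not_not)
    moreover have "a + b = m" using that(1) by (simp add: splits_def)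
    ultimately have "a = ?s" "b = m - ?s"
      by (metis add.right_neutral lookup_add, metis \<open>a + b = m\<close> \<open>lookup b v = 0\<close>
          \<open>a = Poly_Mapping.single v (lookup a v)\<close> add.right_neutral add_diff_cancel_left' lookup_add)
    with that(2) show False by simp
  qed
  have "mps_coeff (mps_of_fps v f * G) m =
      (\<Sum>(a, b)\<in>{(?s, m - ?s)}. mps_coeff (mps_of_fps v f) a * mps_coeff G b)"
    unfolding mps_coeff_times
    using mem zero by (intro sum.mono_neutral_right) auto
  then show ?thesis by (simp add: mps_of_fps_def)
qed

text \<open>The differential equation (x - 1) y' = z y of the power y = (x - 1)^z. For negative z it
  follows from the power rule applied to the inverse \<open>g\<close> of x - 1, since g' =
  -g^2.\<close>

lemma fps_deriv_X_minus_1_powi: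
  "(fps_X - 1 :: complex fps) * fps_deriv ((fps_X - 1) powi z) = of_int z * (fps_X - 1) powi z"
proof (cases "z \<ge> 0")
  case True
  define p where "p = (fps_X - 1 :: complex fps)"
  have "fps_deriv p = 1" by (simp add: p_def)
  then have "p * fps_deriv (p ^ n) = of_nat n * p ^ n" for n
    by (cases n) (simp_all add: fps_deriv_power fps_of_nat power_commutes mult.left_commute
        power_Suc[symmetric] del: of_nat_Suc power_Suc)
  moreover obtain n where "z = int n"
    using True by (metis nonneg_int_cases)
  ultimately show ?thesis
    unfolding p_def[symmetric] by (simp add: power_int_of_nat)
next
  case False
  define p where "p = (fps_X - 1 :: complex fps)"
  define g where "g = inverse p"
  obtain n where n: "z = - int (Suc n)"
    using False by (metis linorder_not_le neg_int_cases gr0_implies_Suc)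
  have inv: "p * g = 1"
    unfolding g_def p_def using inverse_mult_eq_1[of "fps_X - 1 :: complex fps"]
    by (simp add: mult.commute)
  have "fps_deriv g = - (g * g)"
    unfolding g_def by (subst fps_inverse_deriv) (simp_all add: p_def power2_eq_square)
  then have "fps_deriv (g ^ Suc n) = - (of_nat (Suc n) * g * g ^ Suc n)"
    unfolding fps_deriv_power
    by (simp add: fps_of_nat mult.left_commute mult.commute del: of_nat_Suc)
  \<comment> \<open>The derivative carries one factor \<open>g\<close> too many, which
    \<open>p\<close> absorbs.\<close>
  then have "p * fps_deriv (g ^ Suc n) = - (of_nat (Suc n) * (p * g) * g ^ Suc n)"
    by (simp only: mult_minus_right mult.assoc mult.left_commute)
  then have "p * fps_deriv (g ^ Suc n) = - of_nat (Suc n) * g ^ Suc n"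
    by (simp only: inv mult_1_right mult_minus_left)
  moreover have "p powi z = g ^ Suc n"
    unfolding n g_def by (simp add: power_int_def nat_add_distrib del: power_Suc)
  ultimately show ?thesis
    unfolding p_def[symmetric] by (simp add: n del: of_nat_Suc power_Suc)
qed

text \<open>Comparison of the coefficients of x^k in (x - 1) y' = z y gives k y_k - (k + 1) y_{k+1}
  = z y_k.\<close>

lemma fps_nth_X_minus_1_powi_Suc:
  "of_nat (Suc k) * fps_nth ((fps_X - 1 :: complex fps) powi z) (Suc k) =
    (of_nat k - of_int z) * fps_nth ((fps_X - 1) powi z) k"
proof -
  have "fps_nth ((fps_X - 1 :: complex fps) * fps_deriv ((fps_X - 1) powi z)) k =
      fps_nth (of_int z * (fps_X - 1) powi z) k"
    by (simp only: fps_deriv_X_minus_1_powi)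
  then show ?thesis
    by (cases k) (auto simp: algebra_simps minus_equation_iff[of "fps_nth _ _"] simp flip: fps_of_int)
qed

text \<open>The exponents 2 - n and n have the same parity. This is the initial value for the
  recursion above.\<close>

lemma fps_nth_0_X_minus_1_powi: "fps_nth ((fps_X - 1 :: complex fps) powi (2 - int n)) 0 = (- 1) ^ n"
  by (auto simp: power_int_def fps_nth_power_0 minus_one_power_iff nat_diff_distrib)

definition monom_degree :: "('v \<Rightarrow>\<^sub>0 nat) \<Rightarrow> nat" where
  "monom_degree m = (\<Sum>v\<in>keys m. lookup m v)"

lemma monom_degree_superset:
  assumes "finite A" and "keys m \<subseteq> A"
  shows "monom_degree m = (\<Sum>v\<in>A. lookup m v)"
  unfolding monom_degree_def
  using assms by (intro sum.mono_neutral_left) (auto simp: in_keys_iff)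

lemma monom_degree_add: "monom_degree (a + b) = monom_degree a + monom_degree b"
proof -
  let ?A = "keys a \<union> keys b"
  have "monom_degree (a + b) = (\<Sum>v\<in>?A. lookup (a + b) v)"
    by (rule monom_degree_superset) (auto simp: Poly_Mapping.keys_add)
  also have "\<dots> = (\<Sum>v\<in>?A. lookup a v) + (\<Sum>v\<in>?A. lookup b v)"
    by (simp add: lookup_add sum.distrib)
  also have "\<dots> = monom_degree a + monom_degree b"
    using monom_degree_superset[of ?A a] monom_degree_superset[of ?A b] by simp
  finally show ?thesis .
qed

lemma monom_degree_single: "monom_degree (Poly_Mapping.single v k) = k"
  by (simp add: monom_degree_def)

text \<open>At the monomial \<open>m\<close>, the Euler part of the dilaton equation multiplies by
  the total degree, while the shift of \<open>q e e 1\<close> subtracts the coefficient of the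
  derivative in \<open>(e, 1)\<close>.\<close>

lemma DE_coeff:
  assumes "DE e F"
  shows "of_nat (lookup m (e, 1) + 1) * mps_coeff F (m + Poly_Mapping.single (e, 1) 1) =
    (of_nat (monom_degree m) - 2) * mps_coeff F m"
proof -
  \<comment> \<open>The index 1 is added because the dilaton shift contributes there even if no
    variable of level 1 divides \<open>m\<close>.\<close>
  let ?I = "insert 1 (snd ` keys m)"
  let ?d = "of_nat (lookup m (e, 1) + 1) * mps_coeff F (m + Poly_Mapping.single (e, 1) 1)"
  have term_coeff: "mps_coeff (q e \<alpha> i * pd \<alpha> i F) m =
      of_nat (lookup m (\<alpha>, i)) * mps_coeff F m - (if \<alpha> = e then if i = 1 then ?d else 0 else 0)"
    for \<alpha> i
    unfolding q_def left_diff_distrib mps_coeff_diff mps_coeff_var_times_deriv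
    by (cases "\<alpha> = e \<and> i = 1") (auto simp: mps_deriv_def, auto simp: zero_mps_def)
  have summand_coeff: "mps_coeff (\<Sum>\<alpha>\<in>UNIV. q e \<alpha> i * pd \<alpha> i F) m =
      (\<Sum>\<alpha>\<in>UNIV. of_nat (lookup m (\<alpha>, i))) * mps_coeff F m - (if i = 1 then ?d else 0)" for i
    unfolding mps_coeff_sum term_coeff by (simp add: sum_subtractf sum_distrib_right)
  have zero: "lookup m (\<alpha>, i) = 0" if "i \<notin> ?I" for \<alpha> i
    using that by (force simp: in_keys_iff)
  have "mps_coeff (2 * F) m = (\<Sum>i\<in>?I. mps_coeff (\<Sum>\<alpha>\<in>UNIV. q e \<alpha> i * pd \<alpha> i F) m)"
    using assms unfolding DE_def
    by (rule mps_sums_coeff) (use zero in \<open>auto simp: summand_coeff\<close>)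
  also have "\<dots> = of_nat (\<Sum>i\<in>?I. \<Sum>\<alpha>\<in>UNIV. lookup m (\<alpha>, i)) * mps_coeff F m - ?d"
    unfolding summand_coeff sum_subtractf by (simp add: sum_distrib_right)
  \<comment> \<open>The box \<open>UNIV \<times> ?I\<close> is finite and contains
    \<open>keys m\<close>, so the sum over it is the degree.\<close>
  also have "(\<Sum>i\<in>?I. \<Sum>\<alpha>\<in>UNIV. lookup m (\<alpha>, i)) = (\<Sum>v\<in>UNIV \<times> ?I. lookup m v)"
    by (subst sum.swap) (simp add: sum.cartesian_product)
  also have "\<dots> = monom_degree m"
    by (rule monom_degree_superset[symmetric]) (force intro: finite_cartesian_product)+
  finally have "mps_coeff (2 * F) m = of_nat (monom_degree m) * mps_coeff F m - ?d" .
  moreover have "mps_coeff (2 * F) m = 2 * mps_coeff F m"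
    unfolding mult_2 by (simp add: plus_mps_def)
  ultimately show ?thesis by (simp add: algebra_simps)
qed

lemma DE_coeff_add_single:
  assumes "DE e F" and "(e, 1) \<notin> keys r"
  shows "mps_coeff F (r + Poly_Mapping.single (e, 1) k) =
    fps_nth ((fps_X - 1) powi (2 - int (monom_degree r))) k *
      ((- 1) ^ monom_degree r * mps_coeff F r)"
proof (induction k)
  case 0
  show ?case
    \<comment> \<open>The two equal signs multiply to 1.\<close>
    unfolding fps_nth_0_X_minus_1_powi by (simp flip: power_mult_distrib mult.assoc)
next
  case (Suc k)
  let ?m = "r + Poly_Mapping.single (e, 1) k"
  let ?g = "(fps_X - 1 :: complex fps) powi (2 - int (monom_degree r))"
  let ?C = "(- 1) ^ monom_degree r * mps_coeff F r"
  have "lookup ?m (e, 1) = k"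
    using assms(2) by (simp add: lookup_add in_keys_iff)
  moreover have "?m + Poly_Mapping.single (e, 1) 1 = r + Poly_Mapping.single (e, 1) (Suc k)"
    by (simp add: add.assoc flip: single_add)
  ultimately have "of_nat (Suc k) * mps_coeff F (r + Poly_Mapping.single (e, 1) (Suc k)) =
      (of_nat (monom_degree r + k) - 2) * mps_coeff F ?m"
    using DE_coeff[OF assms(1), of ?m] by (simp add: monom_degree_add monom_degree_single)
  \<comment> \<open>With d the degree of \<open>r\<close>, d + k - 2 = k - (2 - d): the factor in
    the recursion for the exponent 2 - d.\<close>
  also have "\<dots> = (of_nat k - of_int (2 - int (monom_degree r))) * fps_nth ?g k * ?C"
    unfolding Suc.IH by (simp add: algebra_simps)
  also have "\<dots> = of_nat (Suc k) * (fps_nth ?g (Suc k) * ?C)"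
    unfolding fps_nth_X_minus_1_powi_Suc[symmetric] by (simp only: mult.assoc)
  finally show ?case
    by (metis mult_left_cancel nat.distinct(1) of_nat_eq_0_iff)
qed

theorem lemma1p2:
  fixes scale :: "complex \<Rightarrow> 'h::ab_group_add \<Rightarrow> 'h"
    and form :: "'h \<Rightarrow> 'h \<Rightarrow> complex"
    and unit :: 'h
    and \<phi> :: "'n::finite \<Rightarrow> 'h"
    and e :: 'n
    and F :: "'n tseries"
  assumes "state_space scale form unit \<phi> e"
    and "F \<in> GW0 form \<phi> e"
  shows "\<exists>c :: nat \<Rightarrow> 'n tseries.
           (\<forall>n. homogeneous_in (- {(e, 1)}) n (c n)) \<and>
           (\<lambda>n. q11_powi e (2 - int n) * c n) mps_sums F"
proof (intro exI conjI allI)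
  define c :: "nat \<Rightarrow> 'n tseries" where
    "c n = Abs_mps (\<lambda>m. if (e, 1) \<notin> keys m \<and> monom_degree m = n
      then (- 1) ^ n * mps_coeff F m else 0)" for n
  have "DE e F"
    using assms(2) by (simp add: GW0_def)
  show "homogeneous_in (- {(e, 1)}) n (c n)" for n
    by (auto simp: homogeneous_in_def c_def monom_degree_def)
  show "(\<lambda>n. q11_powi e (2 - int n) * c n) mps_sums F"
    unfolding mps_sums_def
  proof
    fix m :: "'n \<times> nat \<Rightarrow>\<^sub>0 nat"
    let ?s = "Poly_Mapping.single (e, 1) (lookup m (e, 1))"
    define r where "r = m - ?s"
    have m: "r + ?s = m"
      unfolding r_def
      by (intro poly_mapping_eqI) (auto simp: lookup_add lookup_minus lookup_single when_def)
    have r: "(e, 1) \<notin> keys r"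
      by (simp add: r_def in_keys_iff lookup_minus)
    \<comment> \<open>Only the summand whose index is the degree of \<open>r\<close> contributes at
      \<open>m\<close>; this yields both local finiteness and the value of the sum.\<close>
    have coeff: "mps_coeff (q11_powi e (2 - int n) * c n) m =
        (if n = monom_degree r then mps_coeff F m else 0)" for n
    proof -
      have "mps_coeff (q11_powi e (2 - int n) * c n) m =
          fps_nth ((fps_X - 1) powi (2 - int n)) (lookup m (e, 1)) * mps_coeff (c n) r"
        unfolding q11_powi_def r_def by (rule mps_coeff_of_fps_times) (simp add: c_def)
      then show ?thesis
        using DE_coeff_add_single[OF \<open>DE e F\<close> r, of "lookup m (e, 1)"] r m by (simp add: c_def)
    qed
    have "{n. mps_coeff (q11_powi e (2 - int n) * c n) m \<noteq> 0} \<subseteq> {monom_degree r}"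
      by (auto simp: coeff)
    moreover from this have "(\<Sum>n | mps_coeff (q11_powi e (2 - int n) * c n) m \<noteq> 0.
        mps_coeff (q11_powi e (2 - int n) * c n) m) =
        (\<Sum>n\<in>{monom_degree r}. mps_coeff (q11_powi e (2 - int n) * c n) m)"
      by (intro sum.mono_neutral_left) auto
    ultimately show "finite {n. mps_coeff (q11_powi e (2 - int n) * c n) m \<noteq> 0} \<and>
        mps_coeff F m = (\<Sum>n | mps_coeff (q11_powi e (2 - int n) * c n) m \<noteq> 0.
          mps_coeff (q11_powi e (2 - int n) * c n) m)"
      by (auto simp: coeff intro: finite_subset)
  qed
qed

end
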